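(* Let $W:X\to Y$ be an arbitrary channel between finite alphabets, where the alphabet of $Y$ is a finite-dimensional vector space over a finite field, let $P_X$ be an arbitrary input distribution, and let $P_{XY}$ be the resulting joint distribution. Suppose the (surjective) linear function $f:Y\to V$ is a protocol for $(k,\varepsilon)$ privacy amplification of $Y$ relative to $X$. Then a $(\log|Y|-k,\,k,\,\varepsilon)$ protocol for simulating the action of $W$ on $X$ can be constructed from $f$ and $P_{XY}$; in particular such a protocol exists.
   Context: A channel is a stochastic map (conditional distribution). $R_V$ denotes the uniform distribution on the alphabet of $V$, and $|Y|$ the alphabet size of $Y$. The variational distance is $\delta(P,Q)=\tfrac12\|P-Q\|_1$. Privacy amplification: for a joint distribution $P_{XY}$, a function $f$ on the alphabet of $Y$ is a protocol for $(k,\varepsilon)$ privacy amplification of $Y$ relative to $X$ if, with $V=f(Y)$, $\log|V|=k$ (where $|V|$ is the size of the codomain of $f$) and $\delta(P_{VX},R_V\times P_X)\le\varepsilon$. Channel simulation: given $W:X\to Y$ and $P_X$, an $(m,r,\varepsilon)$ protocol for simulation of $W$ applied to $X$ consists of an encoding map $E:(X,V)\to T$ and a decoding map $D:(T,V)\to Y'$ (both possibly stochastic; $Y'$ has the same alphabet as $Y$) with $\log|T|=m$, $\log|V|=r$ and $\delta(P_{XY},P_{XY'})\le\varepsilon$, where $Y'=D(E(X,V),V)$ and $V$ is uniformly distributed and independent of $X$ (common randomness available to encoder and decoder). *)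

theory Defs
  imports "HOL-Probability.Probability"
begin

type_synonym ('a, 'b) channel = "'a \<Rightarrow> 'b pmf"

definition var_dist :: "'a::finite pmf \<Rightarrow> 'a pmf \<Rightarrow> real" where
  "var_dist P Q = (1 / 2) * (\<Sum>a\<in>UNIV. \<bar>pmf P a - pmf Q a\<bar>)"

definition joint_pmf :: "'x pmf \<Rightarrow> ('x, 'y) channel \<Rightarrow> ('x \<times> 'y) pmf" where
  "joint_pmf P W = do { x \<leftarrow> P; y \<leftarrow> W x; return_pmf (x, y) }"

text \<open>
  Alphabets of sources are finite types, and the codomain of \<open>f\<close> is the whole type \<open>'v\<close>.
  All logarithms are to base 2.
\<close>

definition privacy_amplification ::
  "('y::finite \<Rightarrow> 'v::finite) \<Rightarrow> ('x::finite \<times> 'y) pmf \<Rightarrow> real \<Rightarrow> real \<Rightarrow> bool" where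
  "privacy_amplification f PXY k \<epsilon> \<longleftrightarrow>
     log 2 (real CARD('v)) = k \<and>
     var_dist (map_pmf (\<lambda>(x, y). (f y, x)) PXY)
              (pair_pmf (pmf_of_set UNIV) (map_pmf fst PXY)) \<le> \<epsilon>"

text \<open>
  The message alphabet \<open>T\<close> and the alphabet \<open>V\<close> of the common randomness belong to the protocol,
  so they are finite sets rather than types: a type cannot be existentially quantified.
\<close>

record ('x, 'v, 't, 'y) sim_protocol =
  msgs :: "'t set"
  rand :: "'v set"
  enc :: "('x \<times> 'v, 't) channel"
  dec :: "('t \<times> 'v, 'y) channel"

definition simulated_joint ::
  "'x pmf \<Rightarrow> ('x, 'v, 't, 'y) sim_protocol \<Rightarrow> ('x \<times> 'y) pmf" where
  "simulated_joint P \<Phi> = do {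
     x \<leftarrow> P;
     v \<leftarrow> pmf_of_set (rand \<Phi>);
     t \<leftarrow> enc \<Phi> (x, v);
     y \<leftarrow> dec \<Phi> (t, v);
     return_pmf (x, y)
   }"

definition simulates ::
  "('x::finite, 'v, 't, 'y::finite) sim_protocol \<Rightarrow> ('x, 'y) channel \<Rightarrow> 'x pmf
     \<Rightarrow> real \<Rightarrow> real \<Rightarrow> real \<Rightarrow> bool" where
  "simulates \<Phi> W P m r \<epsilon> \<longleftrightarrow>
     finite (msgs \<Phi>) \<and> msgs \<Phi> \<noteq> {} \<and> log 2 (real (card (msgs \<Phi>))) = m \<and>
     finite (rand \<Phi>) \<and> rand \<Phi> \<noteq> {} \<and> log 2 (real (card (rand \<Phi>))) = r \<and>
     (\<forall>x. \<forall>v\<in>rand \<Phi>. set_pmf (enc \<Phi> (x, v)) \<subseteq> msgs \<Phi>) \<and>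
     var_dist (joint_pmf P W) (simulated_joint P \<Phi>) \<le> \<epsilon>"

end

theory Submission
  imports Defs
begin

text \<open>
  All fibres of \<open>f\<close> have the size of its kernel, so a letter \<open>y\<close> is encoded losslessly by \<open>f y\<close>
  together with its index within its fibre. Given \<open>x\<close> and the common randomness \<open>v\<close>, the encoder
  samples \<open>y\<close> from \<open>P_XY\<close> conditioned on \<open>X = x\<close> and \<open>f Y = v\<close> and sends only the index; the decoder
  recovers \<open>y\<close> from the index and \<open>v\<close>. The true and the simulated joint distribution then arise by
  applying the same stochastic map to the distribution of \<open>(f Y, X)\<close> and to the product
  distribution, so the claim follows by data processing.
\<close>

text \<open>Data processing: after the triangle inequality, each \<open>K a\<close> contributes
  total mass 1.\<close>

lemma var_dist_bind_le:
  fixes p q :: "'a::finite pmf" and K :: "'a \<Rightarrow> 'b::finite pmf"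
  shows "var_dist (bind_pmf p K) (bind_pmf q K) \<le> var_dist p q"
proof -
  have pmf_bind_sum: "pmf (bind_pmf r K) b = (\<Sum>a\<in>UNIV. pmf r a * pmf (K a) b)" for r b
    by (simp add: pmf_bind integral_measure_pmf[of UNIV])
  have "(\<Sum>b\<in>UNIV. \<bar>pmf (bind_pmf p K) b - pmf (bind_pmf q K) b\<bar>)
      = (\<Sum>b\<in>UNIV. \<bar>\<Sum>a\<in>UNIV. (pmf p a - pmf q a) * pmf (K a) b\<bar>)"
    by (simp add: pmf_bind_sum left_diff_distrib sum_subtractf)
  also have "\<dots> \<le> (\<Sum>b\<in>UNIV. \<Sum>a\<in>UNIV. \<bar>pmf p a - pmf q a\<bar> * pmf (K a) b)"
    by (intro sum_mono order.trans[OF sum_abs]) (simp add: abs_mult)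
  also have "\<dots> = (\<Sum>a\<in>UNIV. \<bar>pmf p a - pmf q a\<bar> * (\<Sum>b\<in>UNIV. pmf (K a) b))"
    by (subst sum.swap) (simp add: sum_distrib_left)
  also have "\<dots> = (\<Sum>a\<in>UNIV. \<bar>pmf p a - pmf q a\<bar>)"
    by (simp add: sum_pmf_eq_1)
  finally show ?thesis
    by (simp add: var_dist_def)
qed

text \<open>Law of total probability: the conditionals of \<open>p\<close> on the fibres of
  \<open>g\<close>, weighted by the law of \<open>g\<close>, recombine to \<open>p\<close>.\<close>

lemma bind_map_cond_pmf:
  "bind_pmf (map_pmf g p) (\<lambda>z. cond_pmf p {w. g w = z}) = p"
proof -
  have "bind_pmf (map_pmf g p) (\<lambda>z. cond_pmf p {w. z = g w}) = p"
  proof (rule bind_cond_pmf_cancel)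
    show "measure p {y. x = g y} = measure (map_pmf g p) {x. x = g y}" if "x = g y" for x y
      using that by (simp add: vimage_def eq_commute)
  qed auto
  then show ?thesis
    by (simp add: eq_commute)
qed

text \<open>Each fibre is a coset of the kernel, nonempty by surjectivity; subtracting one preimage
  of \<open>v\<close> is the bijection.\<close>

lemma card_fibre_eq_card_kernel:
  fixes f :: "'a::{ab_group_add,finite} \<Rightarrow> 'b::ab_group_add"
  assumes "Modules.additive f" and "surj f"
  shows "card (f -` {v}) = card (f -` {0})"
proof -
  interpret Modules.additive f by fact
  obtain y where y: "f y = v"
    using \<open>surj f\<close> by (metis surjD)
  have "bij_betw (\<lambda>z. z - y) (f -` {v}) (f -` {0})"
    by (rule bij_betw_byWitness[where f' = "\<lambda>z. z + y"]) (auto simp: y diff add)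
  then show ?thesis
    by (rule bij_betw_same_card)
qed

lemma ex_fibre_indexing:
  fixes f :: "'a::finite \<Rightarrow> 'b"
  assumes "\<And>v. card (f -` {v}) = n"
  shows "\<exists>(h :: 'a \<Rightarrow> nat) d. (\<forall>y. h y < n) \<and> (\<forall>y. d (h y) (f y) = y)"
proof -
  have "\<exists>e. bij_betw e (f -` {v}) {0..<n}" for v
    using ex_bij_betw_finite_nat[of "f -` {v}"] assms by simp
  then obtain e where e: "\<And>v. bij_betw (e v) (f -` {v}) {0..<n}"
    by metis
  define d where "d t v = inv_into (f -` {v}) (e v) t" for t v
  have "e (f y) y < n" for y
    using bij_betwE[OF e[of "f y"]] by simp
  moreover have "d (e (f y) y) (f y) = y" for y
    unfolding d_def by (rule bij_betw_inv_into_left[OF e]) simp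
  ultimately show ?thesis
    by (intro exI[of _ "\<lambda>y. e (f y) y"] exI[of _ d]) simp
qed

lemma map_fst_joint_pmf: "map_pmf fst (joint_pmf P W) = P"
  by (simp add: joint_pmf_def map_bind_pmf map_return_pmf bind_return_pmf')

text \<open>
  The sampler for the letter \<open>y\<close>, which returns it paired with \<open>x\<close>. The second branch is for
  conditions of probability zero; it only has to yield some \<open>y\<close> with \<open>f y = v\<close>.
\<close>

definition fibre_kernel :: "('y \<Rightarrow> 'v) \<Rightarrow> ('x \<times> 'y) pmf \<Rightarrow> ('v \<times> 'x, 'x \<times> 'y) channel" where
  "fibre_kernel f J = (\<lambda>(v, x).
     if (v, x) \<in> set_pmf (map_pmf (\<lambda>(x, y). (f y, x)) J)
     then cond_pmf J {w. (case w of (x, y) \<Rightarrow> (f y, x)) = (v, x)}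
     else return_pmf (x, inv f v))"

text \<open>The product distribution can charge pairs \<open>(v, x)\<close> outside the support of
  the true one, and decoding has to be exact there too. Hence the default branch is covered as
  well.\<close>

lemma set_pmf_fibre_kernel:
  assumes "surj f" and "(x', y) \<in> set_pmf (fibre_kernel f J (v, x))"
  shows "x' = x \<and> f y = v"
proof (cases "(v, x) \<in> set_pmf (map_pmf (\<lambda>(x, y). (f y, x)) J)")
  case True
  then have "set_pmf J \<inter> {w. (case w of (x, y) \<Rightarrow> (f y, x)) = (v, x)} \<noteq> {}"
    by auto
  from set_cond_pmf[OF this] True assms(2) show ?thesis
    by (simp add: fibre_kernel_def)
next
  case False
  with assms show ?thesis
    by (simp add: fibre_kernel_def surj_f_inv_f)
qed

lemma bind_fibre_kernel:
  "bind_pmf (map_pmf (\<lambda>(x, y). (f y, x)) J) (fibre_kernel f J) = J"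
proof -
  \<comment> \<open>Pairs drawn from the true distribution lie in its support, so the default branch
    never occurs.\<close>
  have "bind_pmf (map_pmf (\<lambda>(x, y). (f y, x)) J) (fibre_kernel f J)
      = bind_pmf (map_pmf (\<lambda>(x, y). (f y, x)) J)
          (\<lambda>z. cond_pmf J {w. (case w of (x, y) \<Rightarrow> (f y, x)) = z})"
    by (intro bind_pmf_cong refl) (auto simp: fibre_kernel_def)
  then show ?thesis
    by (simp only: bind_map_cond_pmf)
qed

definition fibre_protocol ::
  "('y \<Rightarrow> 'v) \<Rightarrow> nat \<Rightarrow> ('y \<Rightarrow> nat) \<Rightarrow> (nat \<Rightarrow> 'v \<Rightarrow> 'y) \<Rightarrow> ('x \<times> 'y) pmf
     \<Rightarrow> ('x, 'v, nat, 'y) sim_protocol" where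
  "fibre_protocol f n h d J =
     \<lparr>msgs = {..<n}, rand = UNIV,
      enc = (\<lambda>(x, v). map_pmf (\<lambda>(x, y). h y) (fibre_kernel f J (v, x))),
      dec = (\<lambda>(t, v). return_pmf (d t v))\<rparr>"

text \<open>Every sampled \<open>y\<close> lies in the fibre over \<open>v\<close>, so decoding its
  index returns \<open>y\<close> itself, and encoder followed by decoder acts as the sampler. The
  independent draws of \<open>x\<close> and \<open>v\<close> commute.\<close>

lemma simulated_joint_fibre_protocol:
  fixes f :: "'y \<Rightarrow> 'v::finite"
  assumes "surj f" and "\<And>y. d (h y) (f y) = y"
  shows "simulated_joint P (fibre_protocol f n h d J)
       = bind_pmf (pair_pmf (pmf_of_set UNIV) P) (fibre_kernel f J)"
proof -
  have "bind_pmf (fibre_kernel f J (v, x)) (\<lambda>w. return_pmf (x, d (h (snd w)) v))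
      = fibre_kernel f J (v, x)" for v x
  proof -
    have "bind_pmf (fibre_kernel f J (v, x)) (\<lambda>w. return_pmf (x, d (h (snd w)) v))
        = bind_pmf (fibre_kernel f J (v, x)) return_pmf"
      using assms by (intro bind_pmf_cong refl) (auto dest!: set_pmf_fibre_kernel[OF assms(1)])
    then show ?thesis
      by (simp add: bind_return_pmf')
  qed
  then show ?thesis
    by (simp add: simulated_joint_def fibre_protocol_def pair_pmf_def bind_map_pmf
        bind_assoc_pmf bind_return_pmf split_beta
        bind_commute_pmf[of P "pmf_of_set UNIV"])
qed

theorem proposition4:
  fixes scaleY :: "'k::{field,finite} \<Rightarrow> 'y::{ab_group_add,finite} \<Rightarrow> 'y"
    and scaleV :: "'k \<Rightarrow> 'v::{ab_group_add,finite} \<Rightarrow> 'v"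
    and f :: "'y \<Rightarrow> 'v"
  assumes "Vector_Spaces.linear scaleY scaleV f"
    and "surj f"
  shows "\<exists>construct :: ('x::finite \<times> 'y) pmf \<Rightarrow> ('x, 'v, nat, 'y) sim_protocol.
    \<forall>(W :: ('x, 'y) channel) (P :: 'x pmf) (k :: real) (\<epsilon> :: real).
      privacy_amplification f (joint_pmf P W) k \<epsilon> \<longrightarrow>
      simulates (construct (joint_pmf P W)) W P (log 2 (real CARD('y)) - k) k \<epsilon>"
proof -
  define n where "n = card (f -` {0})"
  have "Modules.additive f"
    using assms(1)
    by (auto simp: module_hom_eq_linear[symmetric] intro: Modules.additive.intro module_hom.add)
  then have fibres: "card (f -` {v}) = n" for v
    unfolding n_def using \<open>surj f\<close> by (rule card_fibre_eq_card_kernel)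
  then obtain h d where h: "\<And>y. h y < n" and d: "\<And>y. d (h y) (f y) = y"
    using ex_fibre_indexing[of f n] by blast
  \<comment> \<open>The fibres partition the domain into \<open>CARD('v)\<close> classes of size
    \<open>n\<close>; this yields the message length.\<close>
  have card_Y: "CARD('y) = CARD('v) * n"
    using card_UN_disjoint[of UNIV "\<lambda>v. f -` {v}"] fibres
    by (auto simp: vimage_UN[symmetric])
  have "n > 0"
    using h[of 0] by simp
  \<comment> \<open>\<open>n\<close>, \<open>h\<close> and \<open>d\<close> come from
    \<open>f\<close> alone, so the construction sees \<open>W\<close> and \<open>P\<close> only
    through their joint distribution.\<close>
  let ?C = "fibre_protocol f n h d :: ('x \<times> 'y) pmf \<Rightarrow> _"
  show ?thesis
  proof (intro exI[of _ ?C] allI impI)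
    fix W :: "('x, 'y) channel" and P :: "'x pmf" and k \<epsilon> :: real
    let ?J = "joint_pmf P W"
    let ?Q = "map_pmf (\<lambda>(x, y). (f y, x)) ?J" and ?R = "pair_pmf (pmf_of_set UNIV) P"
    assume "privacy_amplification f ?J k \<epsilon>"
    then have k: "log 2 (real CARD('v)) = k" and \<epsilon>: "var_dist ?Q ?R \<le> \<epsilon>"
      by (simp_all add: privacy_amplification_def map_fst_joint_pmf)
    have "var_dist (bind_pmf ?Q (fibre_kernel f ?J)) (bind_pmf ?R (fibre_kernel f ?J)) \<le> \<epsilon>"
      using var_dist_bind_le \<epsilon> by (rule order.trans)
    then have "var_dist ?J (simulated_joint P (?C ?J)) \<le> \<epsilon>"
      by (simp only: bind_fibre_kernel
          simulated_joint_fibre_protocol[of f d h, OF \<open>surj f\<close> d])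
    moreover have "log 2 (real n) = log 2 (real CARD('y)) - k"
      using \<open>n > 0\<close> by (simp add: card_Y log_mult flip: k)
    ultimately show "simulates (?C ?J) W P (log 2 (real CARD('y)) - k) k \<epsilon>"
      using k h \<open>n > 0\<close> by (auto simp: simulates_def fibre_protocol_def)
  qed
qed

end
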